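(* Let $N, d \ge 1$ be integers, let $S \subset \mathbb{Z}_N^d$, and let $f: \mathbb{Z}_N^d \to \mathbb{C}$ be a function such that $\operatorname{supp} \widehat{f} \subset S$. If $2 \le p < \infty$, then $$\|f\|_{L^{\infty}(\mathbb{Z}_N^d)} \le \sqrt{\frac{|S|}{N^{\frac{2d}{p}}}} \cdot \|f\|_{L^p(\mathbb{Z}_N^d)}.$$
   Context: $\mathbb{Z}_N^d$ is the $d$-fold product of the cyclic group $\mathbb{Z}_N=\mathbb{Z}/N\mathbb{Z}$. For $f:\mathbb{Z}_N^d\to\mathbb{C}$ the Fourier transform $\widehat f:\mathbb{Z}_N^d\to\mathbb{C}$ is $\widehat f(m)=N^{-d/2}\sum_{x\in\mathbb{Z}_N^d} f(x)e^{-2\pi i\, x\cdot m/N}$, where $x\cdot m=\sum_{j=1}^d x_jm_j$. Norms are with respect to counting measure: $\|f\|_{L^p(\mathbb{Z}_N^d)}=\left(\sum_{x\in\mathbb{Z}_N^d}|f(x)|^p\right)^{1/p}$ for $1\le p<\infty$ and $\|f\|_{L^\infty(\mathbb{Z}_N^d)}=\max_{x\in\mathbb{Z}_N^d}|f(x)|$. $\operatorname{supp}$ denotes the set of points where a function is nonzero. *)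

theory Defs
  imports "HOL-Analysis.Analysis" "HOL-Algebra.Algebra"
begin

(* For N >= 1 the carrier of integer_mod_group N is {0..<int N}, so points are tuples of least
   nonnegative residues, extensional outside the index set {1..d}.  Functions on the group are HOL
   functions whose values off the carrier are irrelevant: everything below ranges over the carrier
   only. *)
definition ZNd :: "nat \<Rightarrow> nat \<Rightarrow> (nat \<Rightarrow> int) set" where
  "ZNd N d = carrier (product_group {1..d} (\<lambda>_. integer_mod_group N))"

(* The integer dot product of representatives; modulo N it does not depend on the representatives,
   hence neither does the character value in the Fourier transform. *)
definition dot :: "nat \<Rightarrow> (nat \<Rightarrow> int) \<Rightarrow> (nat \<Rightarrow> int) \<Rightarrow> int" where
  "dot d x m = (\<Sum>j=1..d. x j * m j)"

definition fourier ::
  "nat \<Rightarrow> nat \<Rightarrow> ((nat \<Rightarrow> int) \<Rightarrow> complex) \<Rightarrow> (nat \<Rightarrow> int) \<Rightarrow> complex" where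
  "fourier N d f m =
     of_real (real N powr (- (real d / 2))) *
     (\<Sum>x\<in>ZNd N d. f x * exp (- 2 * of_real pi * \<i> * of_int (dot d x m) / of_nat N))"

definition supp :: "nat \<Rightarrow> nat \<Rightarrow> ((nat \<Rightarrow> int) \<Rightarrow> complex) \<Rightarrow> (nat \<Rightarrow> int) set" where
  "supp N d g = {x \<in> ZNd N d. g x \<noteq> 0}"

definition Lp_norm :: "nat \<Rightarrow> nat \<Rightarrow> real \<Rightarrow> ((nat \<Rightarrow> int) \<Rightarrow> complex) \<Rightarrow> real" where
  "Lp_norm N d p f = (\<Sum>x\<in>ZNd N d. norm (f x) powr p) powr (1 / p)"

definition Linf_norm :: "nat \<Rightarrow> nat \<Rightarrow> ((nat \<Rightarrow> int) \<Rightarrow> complex) \<Rightarrow> real" where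
  "Linf_norm N d f = Max ((\<lambda>x. norm (f x)) ` ZNd N d)"

end

theory Submission
  imports Defs "HOL-Library.Real_Mod"
begin

text \<open>
  Fourier inversion writes $f$ as a sum over $S$ of $\hat f$ against characters of modulus 1, so
  Cauchy--Schwarz and Plancherel give
  $|f(x)|^2 \le N^{-d}\,|S|\,\|f\|_2^2$.  The power mean inequality on the $N^d$ points of the group
  replaces $\|f\|_2^2$ by $N^{d(1-2/p)}\,\|f\|_p^2$.
\<close>

section \<open>Additive characters of the cyclic group\<close>

definition unity_char :: "nat \<Rightarrow> int \<Rightarrow> complex" where
  "unity_char N k = cis (2 * pi * of_int k / of_nat N)"

lemma norm_unity_char [simp]: "norm (unity_char N k) = 1"
  by (simp add: unity_char_def)

lemma unity_char_0 [simp]: "unity_char N 0 = 1"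
  by (simp add: unity_char_def)

lemma unity_char_add: "unity_char N (a + b) = unity_char N a * unity_char N b"
  by (simp add: unity_char_def cis_mult ring_distribs add_divide_distrib)

lemma unity_char_sum: "unity_char N (sum g A) = (\<Prod>j\<in>A. unity_char N (g j))"
  by (induction A rule: infinite_finite_induct) (auto simp: unity_char_add)

lemma cnj_unity_char: "cnj (unity_char N k) = unity_char N (- k)"
  by (simp add: unity_char_def flip: cis_cnj)

lemma unity_char_mult_nat: "unity_char N (a * int k) = unity_char N a ^ k"
  by (simp add: unity_char_def Complex.DeMoivre mult_ac)

lemma unity_char_eq_1_iff:
  assumes "N \<ge> 1"
  shows "unity_char N k = 1 \<longleftrightarrow> int N dvd k"
proof -
  have "2 * pi * of_int k / of_nat N = of_int n * (2 * pi) \<longleftrightarrow> k = n * int N" for n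
  proof -
    have "2 * pi * of_int k / of_nat N = of_int n * (2 * pi) \<longleftrightarrow> real_of_int k = real_of_int (n * int N)"
      using assms by (simp add: field_simps)
    then show ?thesis by linarith
  qed
  then show ?thesis
    unfolding unity_char_def cis_eq_1_iff dvd_def by (simp add: mult.commute)
qed

text \<open>A geometric sum whose ratio \<open>unity_char N a\<close> is an N-th root of unity: if
  the ratio is not 1 the numerator \<open>1 - r ^ N\<close> vanishes, and the ratio is 1 exactly
  when N divides a.\<close>

lemma sum_unity_char:
  assumes "N \<ge> 1"
  shows "(\<Sum>k\<in>{0..<int N}. unity_char N (a * k)) = (if int N dvd a then of_nat N else 0)"
proof -
  have "(\<Sum>k\<in>{0..<int N}. unity_char N (a * k)) = (\<Sum>k<N. unity_char N a ^ k)"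
    by (intro sum.reindex_bij_witness[of _ int nat]) (auto simp flip: unity_char_mult_nat)
  moreover have "unity_char N a ^ N = 1"
    using unity_char_eq_1_iff[OF assms] by (simp flip: unity_char_mult_nat)
  ultimately show ?thesis
    using unity_char_eq_1_iff[OF assms, of a] by (auto simp: sum_gp_strict)
qed

section \<open>Points of the product group and orthogonality of characters\<close>

lemma ZNd_eq_PiE:
  assumes "N \<ge> 1"
  shows "ZNd N d = (\<Pi>\<^sub>E j\<in>{1..d}. {0..<int N})"
  using assms by (simp add: ZNd_def carrier_integer_mod_group)

lemma finite_ZNd [simp]: "N \<ge> 1 \<Longrightarrow> finite (ZNd N d)"
  by (simp add: ZNd_eq_PiE finite_PiE)

lemma card_ZNd: "N \<ge> 1 \<Longrightarrow> card (ZNd N d) = N ^ d"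
  by (simp add: ZNd_eq_PiE card_PiE)

lemma ZNd_nonempty: "N \<ge> 1 \<Longrightarrow> ZNd N d \<noteq> {}"
  by (auto simp: ZNd_eq_PiE PiE_eq_empty_iff)

lemma dot_diff_left: "dot d (\<lambda>j. x j - y j) m = dot d x m - dot d y m"
  by (simp add: dot_def algebra_simps sum_subtractf)

text \<open>A character of the product group is a product of characters of the coordinates, so the
  sum over all m factors into d one-dimensional sums, each of which is N or 0.\<close>

lemma ZNd_orthogonality:
  assumes N: "N \<ge> 1" and x: "x \<in> ZNd N d" and y: "y \<in> ZNd N d"
  shows "(\<Sum>m\<in>ZNd N d. unity_char N (dot d x m - dot d y m)) = (if x = y then of_nat N ^ d else 0)"
proof -
  have "(\<Sum>m\<in>ZNd N d. unity_char N (dot d x m - dot d y m))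
      = (\<Sum>m\<in>ZNd N d. \<Prod>j\<in>{1..d}. unity_char N ((x j - y j) * m j))"
    unfolding dot_diff_left[symmetric] by (simp add: unity_char_sum dot_def)
  also have "\<dots> = (\<Prod>j\<in>{1..d}. \<Sum>k\<in>{0..<int N}. unity_char N ((x j - y j) * k))"
    unfolding ZNd_eq_PiE[OF N] by (rule prod_sum_PiE[symmetric]) auto
  also have "\<dots> = (\<Prod>j\<in>{1..d}. if x j = y j then of_nat N else 0)"
  proof (rule prod.cong)
    fix j assume "j \<in> {1..d}"
    then have "x j \<in> {0..<int N}" "y j \<in> {0..<int N}"
      using x y unfolding ZNd_eq_PiE[OF N] by (blast dest: PiE_mem)+
    \<comment> \<open>Both coordinates are least residues, so congruence modulo N forces
      equality.\<close>
    then have "int N dvd x j - y j \<longleftrightarrow> x j = y j"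
      by (metis atLeastLessThan_iff mod_eq_dvd_iff mod_pos_pos_trivial)
    then show "(\<Sum>k\<in>{0..<int N}. unity_char N ((x j - y j) * k)) = (if x j = y j then of_nat N else 0)"
      by (simp add: sum_unity_char[OF N])
  qed simp
  also have "\<dots> = (if x = y then of_nat N ^ d else 0)"
  proof (cases "x = y")
    case False
    \<comment> \<open>Points are extensional outside \<open>{1..d}\<close>, so distinct points
      differ at an index inside; the factor at that index is 0.\<close>
    then obtain j where "j \<in> {1..d}" "x j \<noteq> y j"
      using x y unfolding ZNd_eq_PiE[OF N] by (meson PiE_ext)
    with False show ?thesis by (auto intro!: prod_zero)
  qed simp
  finally show ?thesis .
qed

section \<open>Fourier inversion and Plancherel\<close>

lemma fourier_eq_unity_char:
  "fourier N d f m =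
     of_real (real N powr (- (real d / 2))) * (\<Sum>x\<in>ZNd N d. f x * unity_char N (- dot d x m))"
  unfolding fourier_def unity_char_def cis_conv_exp by (simp add: mult_ac)

lemma powr_neg_half_square:
  assumes "N \<ge> 1"
  shows "real N powr (- (real d / 2)) * real N powr (- (real d / 2)) = 1 / real N ^ d"
  using assms by (simp add: powr_minus_divide powr_realpow flip: powr_add)

text \<open>After unfolding the transform and exchanging the sums, orthogonality keeps only the term
  y = x, with weight N^d; the two normalizing factors multiply to N^(-d) and cancel it.\<close>

lemma fourier_inversion:
  assumes N: "N \<ge> 1" and x: "x \<in> ZNd N d"
  shows "f x = of_real (real N powr (- (real d / 2))) *
           (\<Sum>m\<in>ZNd N d. fourier N d f m * unity_char N (dot d x m))"
proof -
  let ?Z = "ZNd N d" and ?c = "complex_of_real (real N powr (- (real d / 2)))"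
  have "?c * (\<Sum>m\<in>?Z. fourier N d f m * unity_char N (dot d x m))
      = ?c * ?c * (\<Sum>m\<in>?Z. \<Sum>y\<in>?Z. f y * unity_char N (dot d x m - dot d y m))"
    unfolding diff_conv_add_uminus unity_char_add fourier_eq_unity_char
    by (simp add: sum_distrib_left sum_distrib_right mult_ac)
  also have "(\<Sum>m\<in>?Z. \<Sum>y\<in>?Z. f y * unity_char N (dot d x m - dot d y m))
      = (\<Sum>y\<in>?Z. f y * (\<Sum>m\<in>?Z. unity_char N (dot d x m - dot d y m)))"
    by (subst sum.swap) (simp add: sum_distrib_left)
  also have "\<dots> = (\<Sum>y\<in>?Z. if x = y then f y * of_nat N ^ d else 0)"
    using ZNd_orthogonality[OF N x] by (intro sum.cong) auto
  also have "\<dots> = f x * of_nat N ^ d"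
    using N x by (simp add: sum.delta')
  also have "?c * ?c = 1 / of_nat N ^ d"
    using powr_neg_half_square[OF N, of d] by (simp flip: of_real_mult)
  finally show ?thesis
    using N by simp
qed

text \<open>Inversion is applied to one factor of \<open>cnj (f x) * f x\<close> only; summing over
  x first then produces the conjugate of the transform.\<close>

lemma plancherel:
  assumes N: "N \<ge> 1"
  shows "(\<Sum>m\<in>ZNd N d. (norm (fourier N d f m))\<^sup>2) = (\<Sum>x\<in>ZNd N d. (norm (f x))\<^sup>2)"
proof -
  let ?Z = "ZNd N d" and ?c = "complex_of_real (real N powr (- (real d / 2)))"
  have "of_real (\<Sum>x\<in>?Z. (norm (f x))\<^sup>2) = (\<Sum>x\<in>?Z. cnj (f x) * f x)"
    unfolding of_real_sum complex_norm_square by (simp add: mult.commute)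
  also have "\<dots> = (\<Sum>x\<in>?Z. cnj (f x) *
        (?c * (\<Sum>m\<in>?Z. fourier N d f m * unity_char N (dot d x m))))"
    using fourier_inversion[OF N, of _ d f] by (intro sum.cong) auto
  also have "\<dots> = (\<Sum>m\<in>?Z. \<Sum>x\<in>?Z.
        cnj (f x) * (?c * (fourier N d f m * unity_char N (dot d x m))))"
    by (subst sum.swap) (simp add: sum_distrib_left)
  also have "\<dots> = (\<Sum>m\<in>?Z. fourier N d f m * cnj (fourier N d f m))"
    \<comment> \<open>Only the conjugated transform is unfolded: conjugation flips the sign in the
      character and fixes the real factor \<open>?c\<close>.\<close>
    by (rule sum.cong[OF refl], subst (3) fourier_eq_unity_char)
      (simp add: cnj_unity_char sum_distrib_left mult_ac)
  also have "\<dots> = of_real (\<Sum>m\<in>?Z. (norm (fourier N d f m))\<^sup>2)"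
    unfolding of_real_sum complex_norm_square ..
  finally show ?thesis
    by (simp only: of_real_eq_iff)
qed

text \<open>The power mean inequality with denominators cleared, obtained from Jensen for the convex
  function t^q.\<close>

lemma sum_powr_le_card:
  fixes a :: "'a \<Rightarrow> real"
  assumes fin: "finite A" and a: "\<And>i. i \<in> A \<Longrightarrow> a i \<ge> 0" and q: "q \<ge> 1"
  shows "(\<Sum>i\<in>A. a i) powr q \<le> real (card A) powr (q - 1) * (\<Sum>i\<in>A. a i powr q)"
proof -
  text \<open>Jensen's inequality is applied on the support of \<open>a\<close> because the library states convexity
    of \<open>powr\<close> only on the open half-line.\<close>
  define T where "T = {i\<in>A. a i \<noteq> 0}"
  have T: "finite T" "T \<subseteq> A" and pos: "\<And>i. i \<in> T \<Longrightarrow> a i > 0"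
    using fin a by (force simp: T_def)+
  have sum_T: "(\<Sum>i\<in>A. a i) = (\<Sum>i\<in>T. a i)" "(\<Sum>i\<in>A. a i powr q) = (\<Sum>i\<in>T. a i powr q)"
    by (intro sum.mono_neutral_right fin; auto simp: T_def)+
  show ?thesis
  proof (cases "T = {}")
    case True
    then show ?thesis
      unfolding sum_T by simp
  next
    case False
    define n where "n = real (card T)"
    have n: "n > 0"
      using T False by (simp add: n_def card_gt_0_iff)
    \<comment> \<open>Jensen with the uniform weights 1/n.\<close>
    have "(\<Sum>i\<in>T. (1 / n) *\<^sub>R a i) powr q \<le> (\<Sum>i\<in>T. (1 / n) * a i powr q)"
      using T False n pos
      by (intro convex_on_sum[OF _ _ powr_convex[OF q]]) (auto simp: n_def)
    then have "((\<Sum>i\<in>T. a i) / n) powr q \<le> (\<Sum>i\<in>T. a i powr q) / n"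
      by (simp flip: sum_divide_distrib)
    moreover have "((\<Sum>i\<in>T. a i) / n) powr q = (\<Sum>i\<in>T. a i) powr q / n powr q"
      by (rule powr_divide)
    ultimately have "(\<Sum>i\<in>T. a i) powr q \<le> n powr (q - 1) * (\<Sum>i\<in>T. a i powr q)"
      using n by (simp add: powr_diff field_simps)
    \<comment> \<open>The exponent q - 1 is nonnegative, so passing from the support back to A only
      enlarges the bound.\<close>
    also have "\<dots> \<le> real (card A) powr (q - 1) * (\<Sum>i\<in>T. a i powr q)"
      using n q card_mono[OF fin T(2)]
      by (intro mult_right_mono powr_mono2 sum_nonneg) (auto simp: n_def)
    finally show ?thesis
      unfolding sum_T .
  qed
qed

text \<open>The power mean inequality is used for the values |f|^2 with exponent p/2, which is at
  least 1 because p >= 2. Taking the power 2/p of both sides turns the cardinality factor into N^(d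
  - 2d/p).\<close>

lemma sum_norm_square_le_Lp_norm:
  assumes N: "N \<ge> 1" and p: "p \<ge> 2"
  shows "(\<Sum>x\<in>ZNd N d. (norm (f x))\<^sup>2) \<le> real N ^ d / real N powr (2 * real d / p) * (Lp_norm N d p f)\<^sup>2"
proof -
  define A where "A = (\<Sum>x\<in>ZNd N d. (norm (f x))\<^sup>2)"
  define B where "B = (\<Sum>x\<in>ZNd N d. norm (f x) powr p)"
  have A: "A \<ge> 0" and B: "B \<ge> 0"
    by (auto simp: A_def B_def intro!: sum_nonneg)
  have "((norm (f x))\<^sup>2) powr (p / 2) = norm (f x) powr p" for x
    using powr_powr[of "norm (f x)" 2 "p / 2"] by simp
  then have "A powr (p / 2) \<le> real (N ^ d) powr (p / 2 - 1) * B"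
    using sum_powr_le_card[of "ZNd N d" "\<lambda>x. (norm (f x))\<^sup>2" "p / 2"] N p
    by (simp add: A_def B_def card_ZNd)
  then have "(A powr (p / 2)) powr (2 / p) \<le> (real (N ^ d) powr (p / 2 - 1) * B) powr (2 / p)"
    using p by (intro powr_mono2) auto
  also have "(A powr (p / 2)) powr (2 / p) = A"
    using A p by (simp add: powr_powr)
  also have "(real (N ^ d) powr (p / 2 - 1) * B) powr (2 / p)
      = (real (N ^ d) powr (p / 2 - 1)) powr (2 / p) * B powr (2 / p)"
    using B by (simp add: powr_mult)
  also have "(real (N ^ d) powr (p / 2 - 1)) powr (2 / p) = real N powr (real d - 2 * real d / p)"
  proof -
    have "real d * (p / 2 - 1) * (2 / p) = real d - 2 * real d / p"
      using p by (simp add: field_simps)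
    moreover have "real (N ^ d) = real N powr real d"
      using N by (simp add: powr_realpow)
    ultimately show ?thesis
      by (simp only: powr_powr)
  qed
  also have "\<dots> = real N ^ d / real N powr (2 * real d / p)"
    using N by (simp add: powr_diff powr_realpow)
  also have "B powr (2 / p) = (Lp_norm N d p f)\<^sup>2"
    by (simp add: Lp_norm_def B_def powr_powr power2_eq_square flip: powr_add)
  finally show ?thesis
    by (simp add: A_def)
qed

section \<open>The pointwise bound and the maximum\<close>

lemma norm_square_le_card_spectrum:
  assumes N: "N \<ge> 1" and S: "S \<subseteq> ZNd N d" "supp N d (fourier N d f) \<subseteq> S"
    and x: "x \<in> ZNd N d"
  shows "(norm (f x))\<^sup>2 \<le> real (card S) / real N ^ d * (\<Sum>y\<in>ZNd N d. (norm (f y))\<^sup>2)"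
proof -
  let ?Z = "ZNd N d" and ?g = "fourier N d f" and ?c = "real N powr (- (real d / 2))"
  have "norm (f x) = ?c * norm (\<Sum>m\<in>?Z. ?g m * unity_char N (dot d x m))"
    by (subst fourier_inversion[OF N x]) (simp add: norm_mult)
  \<comment> \<open>The transform vanishes off S, so the inversion sum runs over S alone.\<close>
  also have "(\<Sum>m\<in>?Z. ?g m * unity_char N (dot d x m)) = (\<Sum>m\<in>S. ?g m * unity_char N (dot d x m))"
    using S N by (intro sum.mono_neutral_right) (auto simp: supp_def)
  also have "norm \<dots> \<le> (\<Sum>m\<in>S. norm (?g m))"
    by (rule sum_norm_le) (simp add: norm_mult)
  finally have "norm (f x) \<le> ?c * (\<Sum>m\<in>S. norm (?g m))"
    by (simp add: mult_left_mono)
  then have "(norm (f x))\<^sup>2 \<le> (?c * (\<Sum>m\<in>S. norm (?g m)))\<^sup>2"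
    by (rule power_mono) simp
  also have "\<dots> = (1 / real N ^ d) * (\<Sum>m\<in>S. norm (?g m))\<^sup>2"
    using powr_neg_half_square[OF N, of d] by (simp add: power2_eq_square mult_ac)
  \<comment> \<open>Cauchy-Schwarz against the constant 1 on S; this is the source of |S|.\<close>
  also have "\<dots> \<le> (1 / real N ^ d) * (real (card S) * (\<Sum>m\<in>S. (norm (?g m))\<^sup>2))"
    using sum_squared_le_sum_of_squares[of "\<lambda>m. norm (?g m)" S]
    by (intro mult_left_mono) (auto simp: mult.commute)
  \<comment> \<open>The sum of squares is extended to the whole group so that Plancherel
    applies.\<close>
  also have "\<dots> \<le> (1 / real N ^ d) * (real (card S) * (\<Sum>m\<in>?Z. (norm (?g m))\<^sup>2))"
    using S N by (intro mult_left_mono sum_mono2) auto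
  finally show ?thesis
    by (simp add: plancherel[OF N])
qed

theorem theorem3:
  fixes N d :: nat and p :: real
    and S :: "(nat \<Rightarrow> int) set" and f :: "(nat \<Rightarrow> int) \<Rightarrow> complex"
  assumes "N \<ge> 1" and "d \<ge> 1"
    and "S \<subseteq> ZNd N d"
    and "supp N d (fourier N d f) \<subseteq> S"
    and "2 \<le> p"
  shows "Linf_norm N d f \<le> sqrt (real (card S) / real N powr (2 * real d / p)) * Lp_norm N d p f"
proof -
  have "norm (f x) \<le> sqrt (real (card S) / real N powr (2 * real d / p)) * Lp_norm N d p f"
    if x: "x \<in> ZNd N d" for x
  proof (rule power2_le_imp_le)
    have "(norm (f x))\<^sup>2 \<le> real (card S) / real N ^ d * (\<Sum>y\<in>ZNd N d. (norm (f y))\<^sup>2)"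
      using norm_square_le_card_spectrum assms x by blast
    also have "\<dots> \<le> real (card S) / real N ^ d *
        (real N ^ d / real N powr (2 * real d / p) * (Lp_norm N d p f)\<^sup>2)"
      using assms by (intro mult_left_mono sum_norm_square_le_Lp_norm) auto
    \<comment> \<open>The factor N^d gained from the power mean cancels the N^(-d) from the
      normalization.\<close>
    also have "\<dots> = (sqrt (real (card S) / real N powr (2 * real d / p)) * Lp_norm N d p f)\<^sup>2"
      using assms by (simp add: power_mult_distrib)
    finally show "(norm (f x))\<^sup>2 \<le> \<dots>" .
  qed (simp add: Lp_norm_def)
  then show ?thesis
    using assms ZNd_nonempty by (simp add: Linf_norm_def)
qed

end
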